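(* Let $k$ be a positive integer, $A$ a stream with $n_A\ge k$ distinct identifiers, $h$ a perfectly random hash function, and let $\alpha^{i}=\mathrm{AlphaTCF}(k,A,h)$ with $\alpha=k/(k+1)$ (so $i$ is the random final counter value). Then $$\mathbb{E}(k/\alpha^i)=n_A,\qquad \sigma^2(k/\alpha^i)=\frac{n_A^2-2n_Ak+k^2-n_A+k}{2k}<\frac{n_A^2}{2k},\qquad \mathrm{S.E.}(k/\alpha^i)<\frac{0.708}{\sqrt k},$$ where $\mathrm{S.E.}(k/\alpha^i)=\sqrt{\sigma^2(k/\alpha^i)}/n_A$ is the relative standard error.
   Context: Identifiers come from $[n]$; a stream is a finite sequence of identifiers. The hash function $h:[n]\to(0,1)$ is perfectly random (i.i.d. Uniform$(0,1)$ values); $h(A)$ is the sequence of hash values in stream order. AlphaTCF$(k,A,h)$: set $\alpha=k/(k+1)$; let the prefix be the shortest prefix of $h(A)$ containing exactly $k$ distinct hash values and the suffix the rest; $D$ := set of distinct hash values in the prefix; $i:=0$; for each $x$ in the suffix, in order: if $x<\alpha^i$ and $x\notin D$, then $i:=i+1$ and $D:=D\cup\{x\}$. Return $\theta=\alpha^i$. *)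

theory Defs
  imports "HOL-Probability.Probability"
begin

text \<open>The hash function is a random function \<open>h \<omega> :: nat \<Rightarrow> real\<close> on the sample space \<open>M\<close>; only its
  values on the identifiers \<open>{1..n}\<close> are constrained.\<close>

definition (in prob_space) perfectly_random_hash :: "nat \<Rightarrow> ('a \<Rightarrow> nat \<Rightarrow> real) \<Rightarrow> bool" where
  "perfectly_random_hash n h \<longleftrightarrow>
     (\<forall>\<omega>\<in>space M. \<forall>a\<in>{1..n}. h \<omega> a \<in> {0<..<1}) \<and>
     indep_vars (\<lambda>_. borel) (\<lambda>a \<omega>. h \<omega> a) {1..n} \<and>
     (\<forall>a\<in>{1..n}. distr M borel (\<lambda>\<omega>. h \<omega> a) = uniform_measure lborel {0<..<1})"

text \<open>If hash collisions leave fewer than \<open>k\<close> distinct values, no prefix qualifies; the whole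
  sequence is then taken as the prefix. For a stream with at least \<open>k\<close> distinct identifiers
  this has probability 0.\<close>

definition prefix_length :: "nat \<Rightarrow> real list \<Rightarrow> nat" where
  "prefix_length k xs =
     (if \<exists>m\<le>length xs. card (set (take m xs)) = k
      then LEAST m. card (set (take m xs)) = k
      else length xs)"

definition tcf_step :: "real \<Rightarrow> real \<Rightarrow> nat \<times> real set \<Rightarrow> nat \<times> real set" where
  "tcf_step \<alpha> x = (\<lambda>(i, D). if x < \<alpha> ^ i \<and> x \<notin> D then (Suc i, insert x D) else (i, D))"

definition AlphaTCF_counter :: "nat \<Rightarrow> nat list \<Rightarrow> (nat \<Rightarrow> real) \<Rightarrow> nat" where
  "AlphaTCF_counter k A h =
     (let \<alpha> = real k / (real k + 1);
          xs = map h A;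
          m = prefix_length k xs
      in fst (fold (tcf_step \<alpha>) (drop m xs) (0, set (take m xs))))"

definition AlphaTCF :: "nat \<Rightarrow> nat list \<Rightarrow> (nat \<Rightarrow> real) \<Rightarrow> real" where
  "AlphaTCF k A h = (real k / (real k + 1)) ^ AlphaTCF_counter k A h"

end

theory Submission imports Defs begin

text \<open>Write \<open>S\<^sub>j = k / \<alpha> ^ i\<close> for the estimate after \<open>j \<ge> k\<close> distinct identifiers. Almost surely
  there are no collisions, and then only a new identifier can change the state; its hash value is
  independent of the counter, so it increments the counter with conditional probability
  \<open>\<alpha> ^ i = k / S\<^sub>j\<close>. Since an increment multiplies \<open>S\<^sub>j\<close> by \<open>1 + 1 / k\<close>, the mean of \<open>S\<^sub>j\<close> grows by
  exactly \<open>1\<close> and that of \<open>S\<^sub>j\<^sup>2\<close> by \<open>(2 * k + 1) / k\<close> times the mean of \<open>S\<^sub>j\<close>, starting from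
  \<open>S\<^sub>k = k\<close>.\<close>

section \<open>Measurability of the counter as a function of the hash values\<close>

text \<open>Outside \<open>I\<close> the component is constantly \<open>undefined\<close> on the
  product space. Covering this case spares the lemmas below any side condition relating identifiers
  to \<open>I\<close>.\<close>

lemma measurable_component_PiM:
  fixes I :: "'i set"
  shows "(\<lambda>g. g a :: real) \<in> borel_measurable (PiM I (\<lambda>_. borel))"
proof (cases "a \<in> I")
  case False
  then have "g a = undefined" if "g \<in> space (PiM I (\<lambda>_. borel :: real measure))" for g
    using that PiE_arb[OF _ False] unfolding space_PiM by metis
  then show ?thesis by (subst measurable_cong[where g = "\<lambda>_. undefined"]) simp_all
qed simp

lemma pred_mem_image:
  assumes "finite E"
  shows "Measurable.pred (PiM I (\<lambda>_. borel)) (\<lambda>g. (g a :: real) \<in> g ` E)"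
proof -
  have eq: "(\<lambda>g. (g a :: real) \<in> g ` E) = (\<lambda>g. \<exists>e\<in>E. g a = g e)" by auto
  show ?thesis unfolding eq unfolding pred_def
    by (intro sets.sets_Collect_finite_Ex assms borel_measurable_eq measurable_component_PiM)
qed

lemma measurable_fold_tcf_step:
  assumes "finite E"
  shows "(\<lambda>g. fst (fold (tcf_step \<alpha>) (map g L) (i, g ` E)))
    \<in> measurable (PiM I (\<lambda>_. borel)) (count_space UNIV)"
  using assms
proof (induction L arbitrary: i E)
  case (Cons a L)
  note measurable_component_PiM[measurable] pred_mem_image[OF Cons.prems, measurable]
  note Cons.IH[OF Cons.prems, measurable]
  have [measurable]: "(\<lambda>g. fst (fold (tcf_step \<alpha>) (map g L) (i, insert (g a) (g ` E))))
    \<in> measurable (PiM I (\<lambda>_. borel)) (count_space UNIV)" for i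
    using Cons.IH[of "insert a E" i] Cons.prems by simp
  have eq: "fst (fold (tcf_step \<alpha>) (map g (a # L)) (i, g ` E)) =
      (if g a < \<alpha> ^ i \<and> g a \<notin> g ` E
       then fst (fold (tcf_step \<alpha>) (map g L) (Suc i, insert (g a) (g ` E)))
       else fst (fold (tcf_step \<alpha>) (map g L) (i, g ` E)))" for g
    by (simp add: tcf_step_def)
  show ?case unfolding eq by measurable
qed simp

lemma measurable_card_image:
  assumes "finite E"
  shows "(\<lambda>g :: 'i \<Rightarrow> real. card (g ` E))
    \<in> measurable (PiM I (\<lambda>_. borel)) (count_space UNIV)"
  using assms
proof (induction E)
  case (insert a E)
  note insert.IH[measurable] pred_mem_image[OF insert.hyps(1), measurable]
  have eq: "card (g ` insert a E) = (if g a \<in> g ` E then card (g ` E) else Suc (card (g ` E)))"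
    for g :: "'i \<Rightarrow> real"
    using insert.hyps by (simp add: card_insert_if)
  show ?case unfolding eq by measurable
qed simp

lemma measurable_prefix_length:
  fixes A :: "'i list"
  shows "(\<lambda>g. prefix_length k (map g A)) \<in> measurable (PiM I (\<lambda>_. borel)) (count_space UNIV)"
proof -
  have [measurable]: "(\<lambda>g :: 'i \<Rightarrow> real. card (g ` set (take m A)))
      \<in> measurable (PiM I (\<lambda>_. borel)) (count_space UNIV)" for m
    by (rule measurable_card_image) simp
  have eq: "prefix_length k (map g A) =
     (if \<exists>m\<in>{..length A}. card (g ` set (take m A)) = k
      then LEAST m. card (g ` set (take m A)) = k else length A)" for g :: "'i \<Rightarrow> real"
    by (auto simp: prefix_length_def take_map)
  show ?thesis unfolding eq by measurable
qed

text \<open>The prefix length is itself random, but it is a natural number; on each of the countably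
  many events fixing it, the counter is a fold with a fixed starting set.\<close>

lemma measurable_AlphaTCF_counter:
  "AlphaTCF_counter k A \<in> measurable (PiM I (\<lambda>_. borel)) (count_space UNIV)"
proof -
  have eq: "AlphaTCF_counter k A = (\<lambda>g. (\<lambda>m g. fst (fold (tcf_step (real k / (real k + 1)))
      (map g (drop m A)) (0, g ` set (take m A)))) (prefix_length k (map g A)) g)"
    by (rule ext) (simp add: AlphaTCF_counter_def Let_def take_map drop_map)
  show ?thesis unfolding eq
    by (rule measurable_compose_countable[OF measurable_fold_tcf_step measurable_prefix_length]) simp
qed

section \<open>Collision-free hash values: a deterministic prefix and the effect of one more
  identifier\<close>

text \<open>A discrete intermediate value argument: each further element raises the number of
  distinct elements by at most one, so no value up to the total is skipped.\<close>

lemma ex_take_card: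
  assumes "k \<le> card (set A)"
  shows "\<exists>m\<le>length A. card (set (take m A)) = k"
  using assms
proof (induction A rule: rev_induct)
  case (snoc a A)
  show ?case
  proof (cases "k \<le> card (set A)")
    case True
    then obtain m where "m \<le> length A" "card (set (take m A)) = k" using snoc.IH by blast
    then show ?thesis by (intro exI[of _ m]) simp
  next
    case False
    then have "card (set (A @ [a])) = k" using snoc.prems by (auto simp: card_insert_if split: if_splits)
    then show ?thesis by (intro exI[of _ "length (A @ [a])"]) simp
  qed
qed simp

text \<open>Off a null set, the hash values may be replaced by the identifiers in the choice of the
  prefix, which makes the prefix deterministic.\<close>

lemma AlphaTCF_counter_split:
  assumes "k \<le> card (set A)"
  obtains P L where "set P \<union> set L = set A" "card (set P) = k"
    "\<And>g. inj_on g (set A) \<Longrightarrow>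
      AlphaTCF_counter k A g = fst (fold (tcf_step (real k / (real k + 1))) (map g L) (0, g ` set P))"
proof -
  define m where "m = (LEAST m. card (set (take m A)) = k)"
  obtain m0 where m0: "m0 \<le> length A" "card (set (take m0 A)) = k"
    using ex_take_card[OF assms] by blast
  have m: "card (set (take m A)) = k" unfolding m_def by (rule LeastI[of _ m0]) fact
  have counter: "AlphaTCF_counter k A g = fst (fold (tcf_step (real k / (real k + 1)))
      (map g (drop m A)) (0, g ` set (take m A)))" if "inj_on g (set A)" for g
  proof -
    \<comment> \<open>Injectivity preserves the number of distinct elements of every prefix, so hash
      values and identifiers reach \<open>k\<close> at the same position.\<close>
    have "card (g ` set (take j A)) = card (set (take j A))" for j
      using that by (meson card_image inj_on_subset set_take_subset)
    then have "prefix_length k (map g A) = m"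
      using m0 by (auto simp: prefix_length_def m_def take_map)
    then show ?thesis by (simp add: AlphaTCF_counter_def take_map drop_map)
  qed
  have "set (take m A) \<union> set (drop m A) = set A"
    by (metis append_take_drop_id set_append)
  then show thesis using m counter that by blast
qed

text \<open>A rejected value stays rejected because the thresholds \<open>\<alpha> ^ i\<close> decrease.\<close>

lemma fold_tcf_step_invariant:
  assumes "0 \<le> \<alpha>" "\<alpha> \<le> 1" "fold (tcf_step \<alpha>) (map g L) (0, g ` S) = (i, D)"
  shows "D \<subseteq> g ` (S \<union> set L)" "\<And>s. s \<in> S \<union> set L \<Longrightarrow> g s \<in> D \<or> \<alpha> ^ i \<le> g s" "i \<le> length L"
proof -
  \<comment> \<open>The second conjunct makes repeated identifiers harmless; the third bounds the
    counter, which later yields integrability and finite sums.\<close>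
  have "D \<subseteq> g ` (S \<union> set L) \<and> (\<forall>s\<in>S \<union> set L. g s \<in> D \<or> \<alpha> ^ i \<le> g s) \<and> i \<le> length L"
    using assms(3)
  proof (induction L arbitrary: i D rule: rev_induct)
    case (snoc a L)
    obtain j E where jE: "fold (tcf_step \<alpha>) (map g L) (0, g ` S) = (j, E)" by fastforce
    note IH = snoc.IH[OF jE]
    have step: "tcf_step \<alpha> (g a) (j, E) = (i, D)" using snoc.prems jE by simp
    have "\<alpha> ^ Suc j \<le> \<alpha> ^ j" using assms by (intro power_decreasing) auto
    then have mono: "\<alpha> ^ Suc j \<le> x" if "\<alpha> ^ j \<le> x" for x using that by linarith
    show ?case
    proof (cases "g a < \<alpha> ^ j \<and> g a \<notin> E")
      case True
      then have iD: "i = Suc j" "D = insert (g a) E" using step by (auto simp: tcf_step_def)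
      have "g s \<in> D \<or> \<alpha> ^ i \<le> g s" if "s \<in> S \<union> set (L @ [a])" for s
        unfolding iD using IH mono[of "g s"] that by auto
      then show ?thesis using IH iD by auto
    next
      case False
      then have iD: "i = j" "D = E" using step by (auto simp: tcf_step_def)
      then show ?thesis using IH False by auto
    qed
  qed simp
  then show "D \<subseteq> g ` (S \<union> set L)" "\<And>s. s \<in> S \<union> set L \<Longrightarrow> g s \<in> D \<or> \<alpha> ^ i \<le> g s" "i \<le> length L"
    by auto
qed

text \<open>The starting set is a parameter instead of being computed from the stream, so
  \<open>L\<close> can grow at its end while the start stays fixed.\<close>

definition counter :: "real \<Rightarrow> 'i set \<Rightarrow> 'i list \<Rightarrow> ('i \<Rightarrow> real) \<Rightarrow> nat" where
  "counter \<alpha> S L g = fst (fold (tcf_step \<alpha>) (map g L) (0, g ` S))"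

text \<open>The random test for a stored value becomes a deterministic test on identifiers. By
  injectivity a new identifier has a value that is not stored; by the invariant an old one is stored
  or lies at or above the threshold.\<close>

lemma counter_snoc:
  assumes "0 \<le> \<alpha>" "\<alpha> \<le> 1" "inj_on g (insert a (S \<union> set L))"
  shows "counter \<alpha> S (L @ [a]) g =
    (if a \<notin> S \<union> set L \<and> g a < \<alpha> ^ counter \<alpha> S L g then Suc (counter \<alpha> S L g)
     else counter \<alpha> S L g)"
proof -
  obtain i D where iD: "fold (tcf_step \<alpha>) (map g L) (0, g ` S) = (i, D)" by fastforce
  note inv = fold_tcf_step_invariant[OF assms(1,2) iD]
  have "g a \<notin> D" if "a \<notin> S \<union> set L"
    using inv(1) assms(3) that by (auto simp: inj_on_def)
  then show ?thesis using inv(2)[of a] iD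
    by (auto simp: counter_def tcf_step_def)
qed

section \<open>Expectations involving independent variables\<close>

context prob_space
begin

text \<open>Fubini: the joint law is a product, and for each value \<open>x\<close> of
  \<open>U\<close> the slice where \<open>V\<close> equals \<open>x\<close> is null because
  \<open>V\<close> has no atoms.\<close>

lemma AE_neq_of_indep:
  assumes "indep_var borel U borel V" "\<And>x. measure (distr M borel V) {x} = 0"
  shows "AE \<omega> in M. U \<omega> \<noteq> (V \<omega> :: real)"
proof -
  have [measurable]: "random_variable borel U" "random_variable borel V"
    using assms(1) by (auto dest: indep_var_rv1 indep_var_rv2)
  interpret U: prob_space "distr M borel U" by (rule prob_space_distr) simp
  interpret V: prob_space "distr M borel V" by (rule prob_space_distr) simp
  interpret pair_sigma_finite "distr M borel U" "distr M borel V" ..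
  have "AE x in distr M borel U. AE y in distr M borel V. x \<noteq> y"
  proof (rule AE_I2)
    fix x
    show "AE y in distr M borel V. x \<noteq> y"
      by (rule AE_I[of _ _ "{x}"]) (auto simp: V.emeasure_eq_measure assms(2))
  qed
  moreover have "{p \<in> space (borel \<Otimes>\<^sub>M borel). fst p \<noteq> (snd p :: real)} \<in> sets (borel \<Otimes>\<^sub>M borel)"
    by measurable
  ultimately have "AE p in distr M borel U \<Otimes>\<^sub>M distr M borel V. fst p \<noteq> snd p"
    by (intro AE_pair_measure) (simp_all add: space_pair_measure)
  then have "AE p in distr M (borel \<Otimes>\<^sub>M borel) (\<lambda>\<omega>. (U \<omega>, V \<omega>)). fst p \<noteq> snd p"
    using assms(1) unfolding indep_var_distribution_eq by metis
  then show ?thesis by (subst (asm) AE_distr_iff) auto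
qed

text \<open>Both variables of \<open>indep_var\<close> must take values in the same type, hence the cast of \<open>c\<close>.\<close>

lemma expectation_threshold:
  fixes c :: "'a \<Rightarrow> nat" and U :: "'a \<Rightarrow> real" and f p :: "nat \<Rightarrow> real"
  assumes indep: "indep_var borel (\<lambda>\<omega>. real (c \<omega>)) borel U"
    and unif: "distr M borel U = uniform_measure lborel {0<..<1::real}"
    and bound: "\<And>\<omega>. c \<omega> \<le> N"
    and p: "\<And>j. 0 \<le> p j" "\<And>j. p j \<le> 1"
  shows "expectation (\<lambda>\<omega>. f (c \<omega>) * (if U \<omega> < p (c \<omega>) then 1 else 0 :: real))
    = expectation (\<lambda>\<omega>. p (c \<omega>) * f (c \<omega>))"
proof -
  have [measurable]: "random_variable borel (\<lambda>\<omega>. real (c \<omega>))" "random_variable borel U"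
    using indep by (auto dest: indep_var_rv1 indep_var_rv2)
  \<comment> \<open>The floor undoes the cast, so \<open>c\<close> inherits measurability from
    it.\<close>
  have "(\<lambda>\<omega>. nat \<lfloor>real (c \<omega>)\<rfloor>) \<in> measurable M (count_space UNIV)" by measurable
  then have [measurable]: "c \<in> measurable M (count_space UNIV)" by simp
  let ?C = "\<lambda>j \<omega>. if c \<omega> = j then 1 else 0 :: real"
  let ?U = "\<lambda>j \<omega>. if U \<omega> < p j then 1 else 0 :: real"
  have intC: "integrable M (?C j)" and intU: "integrable M (?U j)" for j
    by (auto intro!: integrable_const_bound[where B = 1])
  have EU: "expectation (?U j) = p j" for j
  proof -
    have "expectation (?U j) = expectation (indicator (U -` {..<p j} \<inter> space M))"
      by (intro Bochner_Integration.integral_cong) (auto simp: indicator_def)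
    also have "\<dots> = measure (distr M borel U) {..<p j}"
      by (simp add: measure_distr)
    also have "\<dots> = measure lborel ({0<..<1} \<inter> {..<p j}) / measure lborel {0<..<1::real}"
      unfolding unif by (subst measure_uniform_measure) auto
    also have "{0<..<1} \<inter> {..<p j} = {0<..<p j}" using p[of j] by auto
    finally show ?thesis using p by simp
  qed
  have ind: "indep_var borel (?C j) borel (?U j)" for j
    using indep_var_compose[OF indep, of "\<lambda>x. if x = real j then 1 else 0 :: real" borel
        "\<lambda>u. if u < p j then 1 else 0 :: real" borel]
    by (simp add: comp_def)
  \<comment> \<open>Since \<open>c\<close> is at most \<open>N\<close>, any expression in it is a
    finite sum over its possible values. In each summand the threshold is a constant, so
    independence factorises the expectation.\<close>
  have expand: "F (c \<omega>) \<omega> = (\<Sum>j\<le>N. ?C j \<omega> * F j \<omega>)" for F :: "nat \<Rightarrow> 'a \<Rightarrow> real" and \<omega>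
    using bound[of \<omega>] by (simp add: if_distrib[of "\<lambda>x. x * _"] cong: if_cong)
  have int: "integrable M (\<lambda>\<omega>. ?C j \<omega> * ?U j \<omega>)" for j
    by (rule indep_var_integrable[OF ind intC intU])
  have "expectation (\<lambda>\<omega>. f (c \<omega>) * ?U (c \<omega>) \<omega>) = expectation (\<lambda>\<omega>. \<Sum>j\<le>N. f j * (?C j \<omega> * ?U j \<omega>))"
    by (subst expand[of "\<lambda>j \<omega>. f j * ?U j \<omega>"]) (simp only: mult.left_commute)
  also have "\<dots> = (\<Sum>j\<le>N. f j * (expectation (?C j) * expectation (?U j)))"
    by (simp only: Bochner_Integration.integral_sum int integrable_mult_right
        integral_mult_right_zero indep_var_lebesgue_integral[OF ind intC intU])
  also have "\<dots> = (\<Sum>j\<le>N. expectation (\<lambda>\<omega>. ?C j \<omega> * (p j * f j)))"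
    by (simp only: EU integral_mult_left_zero) (simp only: mult_ac)
  also have "\<dots> = expectation (\<lambda>\<omega>. \<Sum>j\<le>N. ?C j \<omega> * (p j * f j))"
    by (rule Bochner_Integration.integral_sum[symmetric]) (intro integrable_mult_left intC)
  also have "\<dots> = expectation (\<lambda>\<omega>. p (c \<omega>) * f (c \<omega>))"
    by (simp only: expand[of "\<lambda>j \<omega>. p j * f j"])
  finally show ?thesis .
qed

text \<open>Only finitely many values of \<open>f\<close> occur, so the sum of their absolute values
  is a bound.\<close>

lemma integrable_bounded_nat:
  fixes f :: "nat \<Rightarrow> real"
  assumes "c \<in> measurable M (count_space UNIV)" and "\<And>\<omega>. c \<omega> \<le> N"
  shows "integrable M (\<lambda>\<omega>. f (c \<omega>))"
proof (rule integrable_const_bound)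
  show "AE \<omega> in M. norm (f (c \<omega>)) \<le> (\<Sum>j\<le>N. \<bar>f j\<bar>)"
    using assms(2) by (auto intro!: member_le_sum)
next
  show "(\<lambda>\<omega>. f (c \<omega>)) \<in> borel_measurable M"
    by (rule measurable_compose[OF assms(1)]) simp
qed

section \<open>Independence and injectivity of the random hash values\<close>

context
  fixes n :: nat and h :: "'a \<Rightarrow> nat \<Rightarrow> real"
  assumes hash: "perfectly_random_hash n h"
begin

lemma hash_indep: "indep_vars (\<lambda>_. borel) (\<lambda>a \<omega>. h \<omega> a) {1..n}"
  and hash_uniform: "a \<in> {1..n} \<Longrightarrow> distr M borel (\<lambda>\<omega>. h \<omega> a) = uniform_measure lborel {0<..<1}"
  using hash by (auto simp: perfectly_random_hash_def)

lemma measurable_hash: "a \<in> {1..n} \<Longrightarrow> (\<lambda>\<omega>. h \<omega> a) \<in> borel_measurable M"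
  using hash_indep by (auto simp: indep_vars_def)

lemma measurable_hash_restrict:
  assumes "I \<subseteq> {1..n}"
  shows "(\<lambda>\<omega>. restrict (h \<omega>) I) \<in> measurable M (PiM I (\<lambda>_. borel))"
  using assms by (intro measurable_restrict measurable_hash) auto

text \<open>The last premise says that \<open>F\<close> reads only coordinates in \<open>I\<close>;
  the hash values on the disjoint index sets \<open>I\<close> and \<open>{a}\<close> are
  independent.\<close>

lemma indep_var_function_hash:
  assumes "I \<subseteq> {1..n}" "a \<in> {1..n} - I" "F \<in> borel_measurable (PiM I (\<lambda>_. borel))"
    and "\<And>\<omega>. F (restrict (h \<omega>) I) = F (h \<omega>)"
  shows "indep_var borel (\<lambda>\<omega>. F (h \<omega>)) borel (\<lambda>\<omega>. h \<omega> a)"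
proof -
  have "indep_var (PiM I (\<lambda>_. borel)) (\<lambda>\<omega>. restrict (\<lambda>i. h \<omega> i) I)
      (PiM {a} (\<lambda>_. borel)) (\<lambda>\<omega>. restrict (\<lambda>i. h \<omega> i) {a})"
    using assms(1,2) by (intro indep_var_restrict[OF hash_indep]) auto
  then have "indep_var borel (F \<circ> (\<lambda>\<omega>. restrict (h \<omega>) I)) borel ((\<lambda>g. g a) \<circ> (\<lambda>\<omega>. restrict (h \<omega>) {a}))"
    by (rule indep_var_compose) (use assms(3) in auto)
  then show ?thesis by (simp add: comp_def assms(4))
qed

text \<open>There are finitely many pairs of identifiers, and each collides with probability zero
  because the two values are independent and the uniform law has no atoms.\<close>

lemma AE_inj_hash: "AE \<omega> in M. inj_on (h \<omega>) {1..n}"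
proof -
  have "AE \<omega> in M. h \<omega> a \<noteq> h \<omega> b" if "a \<in> {1..n}" "b \<in> {1..n}" "a \<noteq> b" for a b
  proof (rule AE_neq_of_indep)
    show "indep_var borel (\<lambda>\<omega>. h \<omega> a) borel (\<lambda>\<omega>. h \<omega> b)"
      by (rule indep_var_function_hash[of "{a}" b "\<lambda>g. g a"]) (use that in auto)
    show "measure (distr M borel (\<lambda>\<omega>. h \<omega> b)) {x} = 0" for x
    proof -
      have "emeasure lborel ({0<..<1} \<inter> {x}) \<le> emeasure lborel {x}"
        by (intro emeasure_mono) auto
      then have "measure lborel ({0<..<1} \<inter> {x}) = 0" by (simp add: measure_def)
      then show ?thesis
        unfolding hash_uniform[OF that(2)] by (subst measure_uniform_measure) auto
    qed
  qed
  then have "AE \<omega> in M. \<forall>a\<in>{1..n}. \<forall>b\<in>{1..n}. a \<noteq> b \<longrightarrow> h \<omega> a \<noteq> h \<omega> b"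
    by (intro AE_finite_allI finite_atLeastAtMost AE_impI) auto
  then show ?thesis by eventually_elim (auto simp: inj_on_def)
qed

section \<open>Expected change of a function of the counter\<close>

context
  fixes \<alpha> :: real and S :: "nat set"
  assumes \<alpha>: "0 \<le> \<alpha>" "\<alpha> \<le> 1" and S: "S \<subseteq> {1..n}"
begin

lemma counter_le: "counter \<alpha> S L g \<le> length L"
  unfolding counter_def
  by (rule fold_tcf_step_invariant(3)[OF \<alpha> prod.collapse[symmetric]])

text \<open>The fold reads only hash values of identifiers in \<open>S \<union> set L\<close>, as
  \<open>indep_var_function_hash\<close> requires.\<close>

lemma counter_restrict:
  assumes "S \<union> set L \<subseteq> I"
  shows "counter \<alpha> S L (restrict g I) = counter \<alpha> S L g"
proof -
  have "map (restrict g I) L = map g L" using assms by auto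
  moreover have "restrict g I ` S = g ` S" using assms by (intro image_cong) auto
  ultimately show ?thesis by (simp only: counter_def)
qed

lemma measurable_counter_PiM: "counter \<alpha> S L \<in> measurable (PiM I (\<lambda>_. borel)) (count_space UNIV)"
  unfolding counter_def[abs_def]
  by (rule measurable_fold_tcf_step) (rule finite_subset[OF S finite_atLeastAtMost])

lemma measurable_counter:
  assumes "set L \<subseteq> {1..n}"
  shows "(\<lambda>\<omega>. counter \<alpha> S L (h \<omega>)) \<in> measurable M (count_space UNIV)"
proof -
  have "(\<lambda>\<omega>. counter \<alpha> S L (restrict (h \<omega>) {1..n})) \<in> measurable M (count_space UNIV)"
    by (rule measurable_compose[OF measurable_hash_restrict measurable_counter_PiM]) simp
  then show ?thesis using assms S by (simp add: counter_restrict)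
qed

lemma integrable_counter:
  fixes f :: "nat \<Rightarrow> real"
  assumes "set L \<subseteq> {1..n}"
  shows "integrable M (\<lambda>\<omega>. f (counter \<alpha> S L (h \<omega>)))"
  by (rule integrable_bounded_nat[OF measurable_counter[OF assms] counter_le])

text \<open>A repeated identifier almost surely changes nothing. A new one has a uniform hash value
  independent of the counter, so \<open>f\<close> jumps with conditional probability
  \<open>\<alpha>\<close> to the power of the counter. Arbitrary \<open>f\<close> serves both
  moments.\<close>

lemma expectation_counter_snoc:
  fixes f :: "nat \<Rightarrow> real"
  assumes L: "set (L @ [a]) \<subseteq> {1..n}"
  shows "expectation (\<lambda>\<omega>. f (counter \<alpha> S (L @ [a]) (h \<omega>))) =
    expectation (\<lambda>\<omega>. f (counter \<alpha> S L (h \<omega>))) +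
    (if a \<in> S \<union> set L then 0 else
      expectation (\<lambda>\<omega>. \<alpha> ^ counter \<alpha> S L (h \<omega>) * (f (Suc (counter \<alpha> S L (h \<omega>))) - f (counter \<alpha> S L (h \<omega>)))))"
proof -
  let ?c = "\<lambda>\<omega>. counter \<alpha> S L (h \<omega>)"
  let ?d = "\<lambda>j. f (Suc j) - f j"
  let ?J = "\<lambda>\<omega>. if a \<in> S \<union> set L then 0 else ?d (?c \<omega>) * (if h \<omega> a < \<alpha> ^ ?c \<omega> then 1 else 0)"
  have L': "set L \<subseteq> {1..n}" and a: "a \<in> {1..n}" using L by auto
  note [measurable] = measurable_counter[OF L'] measurable_counter[OF L] measurable_hash[OF a]
  have step: "AE \<omega> in M. f (counter \<alpha> S (L @ [a]) (h \<omega>)) = f (?c \<omega>) + ?J \<omega>"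
    using AE_inj_hash
  proof eventually_elim
    case (elim \<omega>)
    have "insert a (S \<union> set L) \<subseteq> {1..n}" using S L by auto
    then have "inj_on (h \<omega>) (insert a (S \<union> set L))" using elim by (rule inj_on_subset[rotated])
    from counter_snoc[OF \<alpha> this] show ?case by simp
  qed
  \<comment> \<open>The random increment is dominated by the full jump \<open>?d\<close>, a function
    of the bounded counter.\<close>
  have intJ: "integrable M ?J"
  proof (rule Bochner_Integration.integrable_bound)
    show "integrable M (\<lambda>\<omega>. ?d (?c \<omega>))" by (rule integrable_counter[OF L'])
  qed auto
  have "expectation (\<lambda>\<omega>. f (counter \<alpha> S (L @ [a]) (h \<omega>))) = expectation (\<lambda>\<omega>. f (?c \<omega>) + ?J \<omega>)"
    by (rule integral_cong_AE) (use step in auto)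
  also have "\<dots> = expectation (\<lambda>\<omega>. f (?c \<omega>)) + expectation ?J"
    by (rule Bochner_Integration.integral_add[OF integrable_counter[OF L'] intJ])
  also have "expectation ?J = (if a \<in> S \<union> set L then 0 else expectation (\<lambda>\<omega>. \<alpha> ^ ?c \<omega> * ?d (?c \<omega>)))"
  proof (cases "a \<in> S \<union> set L")
    case False
    note [measurable] = measurable_counter_PiM
    have "indep_var borel (\<lambda>\<omega>. real (?c \<omega>)) borel (\<lambda>\<omega>. h \<omega> a)"
      by (rule indep_var_function_hash[of "S \<union> set L" a "\<lambda>g. real (counter \<alpha> S L g)"])
        (use S L False in \<open>auto simp: counter_restrict\<close>)
    from expectation_threshold[OF this hash_uniform[OF a] counter_le, of "\<lambda>j. \<alpha> ^ j" ?d] \<alpha> False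
    show ?thesis by (simp add: power_le_one)
  qed simp
  finally show ?thesis .
qed

end

section \<open>The first two moments of the estimate\<close>

text \<open>With \<open>m\<close> distinct identifiers, the second moment is
  \<open>k\<^sup>2\<close> plus \<open>(2 * k + 1) / k\<close> times the sum of the means
  \<open>j\<close> for \<open>k \<le> j < m\<close>; that sum is
  \<open>(m * (m - 1) - k * (k - 1)) / 2\<close>.\<close>

lemma counter_moments:
  fixes k :: nat and S :: "nat set"
  defines "\<alpha> \<equiv> real k / (real k + 1)"
  assumes k: "k > 0" and S: "S \<subseteq> {1..n}" "card S = k" and L: "set L \<subseteq> {1..n}"
  shows "expectation (\<lambda>\<omega>. real k / \<alpha> ^ counter \<alpha> S L (h \<omega>)) = card (S \<union> set L)"
    and "expectation (\<lambda>\<omega>. (real k / \<alpha> ^ counter \<alpha> S L (h \<omega>))\<^sup>2) =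
      (real k)\<^sup>2 + (2 * real k + 1) / (2 * real k) *
        (real (card (S \<union> set L)) * (real (card (S \<union> set L)) - 1) - real k * (real k - 1))"
proof -
  have \<alpha>: "0 \<le> \<alpha>" "\<alpha> \<le> 1" "\<alpha> > 0" using k by (auto simp: \<alpha>_def)
  let ?X = "\<lambda>L \<omega>. real k / \<alpha> ^ counter \<alpha> S L (h \<omega>)"
  have fin: "finite S" using S(1) by (rule finite_subset) simp
  have "expectation (?X L) = card (S \<union> set L) \<and>
    expectation (\<lambda>\<omega>. (?X L \<omega>)\<^sup>2) = (real k)\<^sup>2 + (2 * real k + 1) / (2 * real k) *
        (real (card (S \<union> set L)) * (real (card (S \<union> set L)) - 1) - real k * (real k - 1))"
    using L
  proof (induction L rule: rev_induct)
    case Nil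
    then show ?case using S by (simp add: counter_def prob_space)
  next
    case (snoc a L)
    then have IH1: "expectation (?X L) = card (S \<union> set L)"
      and IH2: "expectation (\<lambda>\<omega>. (?X L \<omega>)\<^sup>2) = (real k)\<^sup>2 + (2 * real k + 1) / (2 * real k) *
        (real (card (S \<union> set L)) * (real (card (S \<union> set L)) - 1) - real k * (real k - 1))"
      by auto
    note rec = expectation_counter_snoc[OF \<alpha>(1,2) S(1) snoc.prems]
    show ?case
    proof (cases "a \<in> S \<union> set L")
      case True
      then have "S \<union> set (L @ [a]) = S \<union> set L" by auto
      then show ?thesis
        using IH1 IH2 rec[of "\<lambda>j. real k / \<alpha> ^ j"] rec[of "\<lambda>j. (real k / \<alpha> ^ j)\<^sup>2"] True by simp
    next
      case False
      have card: "card (S \<union> set (L @ [a])) = Suc (card (S \<union> set L))"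
        using False fin by simp
      \<comment> \<open>As \<open>1 / \<alpha> = 1 + 1 / k\<close>, the jump is
        \<open>1 / \<alpha> ^ j\<close>, which the acceptance probability cancels.\<close>
      have inc1: "\<alpha> ^ j * (real k / \<alpha> ^ Suc j - real k / \<alpha> ^ j) = 1" for j
      proof -
        have "\<alpha> ^ j * (real k / \<alpha> ^ Suc j - real k / \<alpha> ^ j) = real k / \<alpha> - real k"
          using \<alpha> by (simp add: field_simps)
        also have "\<dots> = 1" using k by (simp add: \<alpha>_def)
        finally show ?thesis .
      qed
      \<comment> \<open>Factoring the difference of squares leaves \<open>inc1\<close> times a
        multiple of the estimate, so the first moment closes the recursion for the second.\<close>
      have inc2: "\<alpha> ^ j * ((real k / \<alpha> ^ Suc j)\<^sup>2 - (real k / \<alpha> ^ j)\<^sup>2)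
          = (2 * real k + 1) / real k * (real k / \<alpha> ^ j)" for j
      proof -
        have "\<alpha> ^ j * ((real k / \<alpha> ^ Suc j)\<^sup>2 - (real k / \<alpha> ^ j)\<^sup>2)
          = (\<alpha> ^ j * (real k / \<alpha> ^ Suc j - real k / \<alpha> ^ j)) * ((real k / \<alpha> ^ j) * (1 / \<alpha> + 1))"
          by (simp add: power2_eq_square field_simps)
        also have "1 / \<alpha> + 1 = (2 * real k + 1) / real k"
          using k by (simp add: \<alpha>_def field_simps)
        finally show ?thesis unfolding inc1 by simp
      qed
      have "expectation (?X (L @ [a])) = card (S \<union> set (L @ [a]))"
        using rec[of "\<lambda>j. real k / \<alpha> ^ j"] False unfolding inc1 IH1 card by (simp add: prob_space)
      moreover have "expectation (\<lambda>\<omega>. (?X (L @ [a]) \<omega>)\<^sup>2) = expectation (\<lambda>\<omega>. (?X L \<omega>)\<^sup>2) +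
          (2 * real k + 1) / real k * card (S \<union> set L)"
        using rec[of "\<lambda>j. (real k / \<alpha> ^ j)\<^sup>2"] False
        unfolding inc2 integral_mult_right_zero IH1 by simp
      \<comment> \<open>The factor \<open>2\<close> matches
        \<open>m * (m + 1) - m * (m - 1) = 2 * m\<close>.\<close>
      moreover have "(2 * real k + 1) / real k = 2 * ((2 * real k + 1) / (2 * real k))"
        using k by (simp add: field_simps)
      ultimately show ?thesis
        unfolding IH2 card of_nat_Suc by (simp only: algebra_simps) simp
    qed
  qed
  then show "expectation (?X L) = card (S \<union> set L)"
    and "expectation (\<lambda>\<omega>. (?X L \<omega>)\<^sup>2) = (real k)\<^sup>2 + (2 * real k + 1) / (2 * real k) *
        (real (card (S \<union> set L)) * (real (card (S \<union> set L)) - 1) - real k * (real k - 1))"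
    by auto
qed

end

end

section \<open>Transfer of the moments to the estimate, and the bounds on variance and error\<close>

theorem theorem16:
  fixes M :: "'w measure" and h :: "'w \<Rightarrow> nat \<Rightarrow> real"
    and n k n\<^sub>A :: nat and A :: "nat list" and X :: "'w \<Rightarrow> real"
  assumes "prob_space M"
    and "prob_space.perfectly_random_hash M n h"
    and "k > 0"
    and "set A \<subseteq> {1..n}"
    and "n\<^sub>A = card (set A)"
    and "n\<^sub>A \<ge> k"
    and "X = (\<lambda>\<omega>. real k / AlphaTCF k A (h \<omega>))"
  shows "integrable M X \<and> integrable M (\<lambda>\<omega>. (X \<omega>)\<^sup>2) \<and>
    prob_space.expectation M X = real n\<^sub>A \<and>
    prob_space.variance M X =
      ((real n\<^sub>A)\<^sup>2 - 2 * real n\<^sub>A * real k + (real k)\<^sup>2 - real n\<^sub>A + real k) / (2 * real k) \<and>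
    prob_space.variance M X < (real n\<^sub>A)\<^sup>2 / (2 * real k) \<and>
    sqrt (prob_space.variance M X) / real n\<^sub>A < 0.708 / sqrt (real k)"
proof -
  interpret prob_space M by fact
  note hash = assms(2)
  define \<alpha> where "\<alpha> = real k / (real k + 1)"
  let ?N = "real n\<^sub>A" and ?k = "real k"
  have \<alpha>: "0 \<le> \<alpha>" "\<alpha> \<le> 1" by (auto simp: \<alpha>_def)
  obtain P L where PL: "set P \<union> set L = set A" "card (set P) = k"
    and split: "\<And>g. inj_on g (set A) \<Longrightarrow>
      AlphaTCF_counter k A g = fst (fold (tcf_step \<alpha>) (map g L) (0, g ` set P))"
    using AlphaTCF_counter_split[of k A] assms(5,6) unfolding \<alpha>_def by metis
  have P: "set P \<subseteq> {1..n}" and L: "set L \<subseteq> {1..n}" using PL(1) assms(4) by auto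
  let ?Y = "\<lambda>\<omega>. ?k / \<alpha> ^ counter \<alpha> (set P) L (h \<omega>)"
  \<comment> \<open>\<open>M\<close> need not be complete, so almost sure equality with
    \<open>?Y\<close> would not make \<open>X\<close> measurable; instead the counter is a
    measurable function of finitely many hash values.\<close>
  have "AlphaTCF_counter k A (restrict g (set A)) = AlphaTCF_counter k A g" for g
  proof -
    have "map (restrict g (set A)) A = map g A" by auto
    then show ?thesis by (simp only: AlphaTCF_counter_def)
  qed
  then have [measurable]: "(\<lambda>\<omega>. AlphaTCF_counter k A (h \<omega>)) \<in> measurable M (count_space UNIV)"
    using measurable_compose[OF measurable_hash_restrict[OF hash assms(4)] measurable_AlphaTCF_counter, of k A]
    by simp
  have X[measurable]: "X \<in> borel_measurable M"
    unfolding assms(7) AlphaTCF_def by measurable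
  have AE: "AE \<omega> in M. X \<omega> = ?Y \<omega>"
    using AE_inj_hash[OF hash]
  proof eventually_elim
    case (elim \<omega>)
    then have "inj_on (h \<omega>) (set A)" using assms(4) by (rule inj_on_subset)
    then show ?case using split by (simp add: assms(7) AlphaTCF_def counter_def \<alpha>_def)
  qed
  have AE2: "AE \<omega> in M. (X \<omega>)\<^sup>2 = (?Y \<omega>)\<^sup>2" using AE by eventually_elim simp
  have intY: "integrable M ?Y" and intY2: "integrable M (\<lambda>\<omega>. (?Y \<omega>)\<^sup>2)"
    by (rule integrable_counter[OF hash \<alpha> P L])+
  note [measurable] = borel_measurable_integrable[OF intY] borel_measurable_integrable[OF intY2]
  have intX: "integrable M X"
    using intY by (rule integrable_cong_AE_imp) (use AE in auto)
  have intX2: "integrable M (\<lambda>\<omega>. (X \<omega>)\<^sup>2)"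
    using intY2 by (rule integrable_cong_AE_imp) (use AE2 in auto)
  note moments = counter_moments[OF hash assms(3) P PL(2) L, folded \<alpha>_def, unfolded PL(1) assms(5)[symmetric]]
  have EX: "expectation X = ?N"
    unfolding moments(1)[symmetric] by (rule integral_cong_AE) (use AE in auto)
  have EX2: "expectation (\<lambda>\<omega>. (X \<omega>)\<^sup>2) =
      ?k\<^sup>2 + (2 * ?k + 1) / (2 * ?k) * (?N * (?N - 1) - ?k * (?k - 1))"
    unfolding moments(2)[symmetric] by (rule integral_cong_AE) (use AE2 in auto)
  have k: "?k > 0" "?k \<le> ?N" using assms(3,6) by auto
  have var: "variance X = (?N\<^sup>2 - 2 * ?N * ?k + ?k\<^sup>2 - ?N + ?k) / (2 * ?k)"
    unfolding variance_eq[OF intX intX2]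
    unfolding EX EX2 using k by (simp add: field_simps power2_eq_square)
  \<comment> \<open>These give \<open>?k\<^sup>2 - 2 * ?N * ?k \<le> - ?N * ?k < 0\<close>, and
    \<open>?k - ?N \<le> 0\<close>, so all terms besides \<open>?N\<^sup>2\<close> sum to a negative
    number.\<close>
  have "?k * ?k \<le> ?N * ?k" "0 < ?N * ?k" using k by (auto intro: mult_right_mono)
  then have "?N\<^sup>2 - 2 * ?N * ?k + ?k\<^sup>2 - ?N + ?k < ?N\<^sup>2"
    using k unfolding power2_eq_square by linarith
  then have lt: "variance X < ?N\<^sup>2 / (2 * ?k)"
    unfolding var using k by (intro divide_strict_right_mono) auto
  \<comment> \<open>The constant is \<open>1 / sqrt 2\<close> rounded up:
    \<open>0.708\<^sup>2 = 0.501264\<close>, which exceeds \<open>1 / 2\<close>.\<close>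
  have "?N\<^sup>2 / (2 * ?k) \<le> (0.708 * ?N / sqrt ?k)\<^sup>2"
    using k by (simp add: power_divide power_mult_distrib field_simps)
  with lt have "sqrt (variance X) < 0.708 * ?N / sqrt ?k"
    using k by (intro real_less_lsqrt) auto
  then have "sqrt (variance X) / ?N < 0.708 / sqrt ?k"
    using k by (simp add: field_simps)
  with intX intX2 EX var lt show ?thesis by blast
qed

end
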